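(* Let $K$ be a field, $R=K[x_1,\ldots,x_n]$, let $v_1,\ldots,v_q\in\mathbb{N}^n$, let $A$ be the $n\times q$ matrix with column vectors $v_1,\ldots,v_q$, assume that all rows and all columns of $A$ are nonzero, and let $I=(x^{v_1},\ldots,x^{v_q})\subset R$. Then $I$ is a normal ideal if and only if the system $xA\geq\mathbf{1};\ x\geq 0$ has the integer rounding property.
   Context: $x^a:=x_1^{a_1}\cdots x_n^{a_n}$ for $a=(a_1,\ldots,a_n)\in\mathbb{N}^n$; $\mathbf{1}$ is the all-ones vector; vector inequalities are componentwise; $\langle\,,\rangle$ is the standard inner product. The integral closure of $I^i$ is $\overline{I^i}=(\{x^a\in R\mid \exists\, p\geq 1:\ (x^a)^p\in I^{pi}\})$. The monomial ideal $I$ is normal if $I^i=\overline{I^i}$ for all $i\geq 1$. For a matrix $A$ with entries in $\mathbb{N}$, the system $x\geq 0;\ xA\geq\mathbf{1}$ has the integer rounding property if $$\max\{\langle y,\mathbf{1}\rangle\mid Ay\leq w;\ y\in\mathbb{N}^q\}=\lfloor\max\{\langle y,\mathbf{1}\rangle\mid y\in\mathbb{R}^q,\ y\geq 0;\ Ay\leq w\}\rfloor$$ for each integral vector $w$ for which the right hand side is finite (in particular the real problem is feasible). *)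

theory Defs
  imports
    "HOL-Analysis.Analysis"
    "HOL-Library.Poly_Mapping"
    "HOL-Algebra.Ideal_Product"
    "HOL-Algebra.Algebraic_Closure_Type"
begin

text \<open>
  The polynomial ring \<open>K[x\<^sub>1,\<dots>,x\<^sub>n]\<close> is the type \<open>(nat ^ 'n) \<Rightarrow>\<^sub>0 'k\<close> of finitely supported
  functions from exponent vectors to coefficients, with convolution as multiplication; the finite
  index type \<open>'n\<close> enumerates the variables. \<open>ring_of_type_algebra\<close> turns this ring type into a
  record, so that the ideal theory of HOL-Algebra applies.
\<close>

definition var :: "'n::finite \<Rightarrow> (nat ^ 'n) \<Rightarrow>\<^sub>0 'k::comm_semiring_1"
  where "var i = Poly_Mapping.single (axis i 1) 1"

definition mono_pow :: "nat ^ 'n::finite \<Rightarrow> (nat ^ 'n) \<Rightarrow>\<^sub>0 'k::comm_semiring_1"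
  where "mono_pow a = (\<Prod>i\<in>UNIV. var i ^ (a $ i))"

lemma var_power:
  fixes i :: "'n::finite"
  shows "var i ^ m = Poly_Mapping.single (axis i m) 1"
proof (induction m)
  case 0
  have "axis i 0 = (0 :: nat ^ 'n)"
    by (simp add: vec_eq_iff axis_def)
  then show ?case
    by (simp only: power_0 single_one)
next
  case (Suc m)
  have "axis i 1 + axis i m = (axis i (Suc m) :: nat ^ 'n)"
    by (simp add: vec_eq_iff axis_def)
  with Suc show ?case
    by (simp add: var_def mult_single)
qed

lemma mono_pow_eq_single: "mono_pow a = Poly_Mapping.single a 1"
proof -
  have *: "(\<Prod>i\<in>S. var i ^ (a $ i)) = Poly_Mapping.single (\<Sum>i\<in>S. axis i (a $ i)) 1"
    if "finite S" for S
    using that by induction (simp_all add: var_power mult_single)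
  have "(\<Sum>i\<in>UNIV. axis i (a $ i)) = a"
    by (simp add: vec_eq_iff axis_def)
  with *[of UNIV] show ?thesis
    by (simp add: mono_pow_def)
qed

abbreviation ideal_gen :: "'a::comm_ring_1 set \<Rightarrow> 'a set"
  where "ideal_gen S \<equiv> genideal ring_of_type_algebra S"

text \<open>\<open>ideals_set R\<close> is the monoid of ideals of \<open>R\<close> under the product of ideals, with unit \<open>R\<close>.\<close>

abbreviation ideal_pow :: "'a::comm_ring_1 set \<Rightarrow> nat \<Rightarrow> 'a set"
  where "ideal_pow I i \<equiv> I [^]\<^bsub>ideals_set ring_of_type_algebra\<^esub> i"

text \<open>The second argument is the exponent: this is the integral closure of the power \<open>I\<^sup>i\<close>.\<close>

definition integral_closure_pow ::
    "((nat ^ 'n::finite) \<Rightarrow>\<^sub>0 'k::field) set \<Rightarrow> nat \<Rightarrow> ((nat ^ 'n) \<Rightarrow>\<^sub>0 'k) set"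
  where "integral_closure_pow I i =
    ideal_gen {mono_pow a | a. \<exists>p\<ge>1. mono_pow a ^ p \<in> ideal_pow I (p * i)}"

definition normal_monomial_ideal :: "((nat ^ 'n::finite) \<Rightarrow>\<^sub>0 'k::field) set \<Rightarrow> bool"
  where "normal_monomial_ideal I \<longleftrightarrow> (\<forall>i\<ge>1. ideal_pow I i = integral_closure_pow I i)"

definition lp_feasible :: "nat ^ 'q::finite ^ 'n::finite \<Rightarrow> real ^ 'n \<Rightarrow> (real ^ 'q) set"
  where "lp_feasible A w = {y. y \<ge> 0 \<and> map_matrix real A *v y \<le> w}"

definition ip_feasible :: "nat ^ 'q::finite ^ 'n::finite \<Rightarrow> real ^ 'n \<Rightarrow> (real ^ 'q) set"
  where "ip_feasible A w = {y. (\<forall>j. y $ j \<in> \<nat>) \<and> map_matrix real A *v y \<le> w}"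

text \<open>
  The real maximum is finite iff the real problem is feasible and bounded. In that case both maxima
  are required to be attained, so that the equation between them is meaningful.
\<close>

definition integer_rounding_property :: "nat ^ 'q::finite ^ 'n::finite \<Rightarrow> bool"
  where "integer_rounding_property A \<longleftrightarrow>
    (\<forall>w. (\<forall>i. w $ i \<in> \<int>) \<longrightarrow>
      lp_feasible A w \<noteq> {} \<longrightarrow> bdd_above ((\<lambda>y. y \<bullet> 1) ` lp_feasible A w) \<longrightarrow>
      (\<exists>y z. is_arg_max (\<lambda>y. y \<bullet> 1) (\<lambda>y. y \<in> ip_feasible A w) y \<and>
             is_arg_max (\<lambda>z. z \<bullet> 1) (\<lambda>z. z \<in> lp_feasible A w) z \<and>
             y \<bullet> 1 = of_int \<lfloor>z \<bullet> 1\<rfloor>))"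

end

theory Submission
  imports Defs
begin

text \<open>
  A monomial \<open>x\<^sup>a\<close> lies in \<open>I\<^sup>i\<close> iff some \<open>y \<in> \<nat>\<^sup>q\<close> with \<open>A y \<le> a\<close> has coordinate sum \<open>i\<close>, and in the
  integral closure of \<open>I\<^sup>i\<close> iff the same holds for some rational \<open>y \<ge> 0\<close>. Hence \<open>I\<close> is normal iff, for
  every \<open>a\<close>, each integer value attained by the rational relaxation is attained by an integer point.
  This is integer rounding, once the real maximum is compared with the rational relaxation.
\<close>

section \<open>Packing columns below an exponent vector\<close>

definition packs :: "nat ^ 'q::finite ^ 'n::finite \<Rightarrow> nat \<Rightarrow> nat ^ 'n \<Rightarrow> bool"
  where "packs A i a \<longleftrightarrow> (\<exists>y. (\<Sum>j\<in>UNIV. y $ j) = i \<and> A *v y \<le> a)"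

lemma packsI:
  fixes y :: "nat ^ 'q::finite"
  shows "(\<Sum>j\<in>UNIV. y $ j) = i \<Longrightarrow> A *v y \<le> a \<Longrightarrow> packs A i a"
  unfolding packs_def by blast

lemma packsE:
  fixes A :: "nat ^ 'q::finite ^ 'n::finite"
  assumes "packs A i a"
  obtains y :: "nat ^ 'q" where "(\<Sum>j\<in>UNIV. y $ j) = i" "A *v y \<le> a"
  using assms unfolding packs_def by blast

lemma packs_zero: "packs A 0 a"
proof (rule packsI)
  show "A *v 0 \<le> a"
    by (simp add: less_eq_vec_def)
qed simp

lemma packs_add:
  fixes A :: "nat ^ 'q::finite ^ 'n::finite"
  assumes "packs A i a" "packs A j b"
  shows "packs A (i + j) (a + b)"
proof -
  obtain y z :: "nat ^ 'q" where "(\<Sum>k\<in>UNIV. y $ k) = i" "A *v y \<le> a" "(\<Sum>k\<in>UNIV. z $ k) = j" "A *v z \<le> b"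
    using assms by (elim packsE)
  then show ?thesis
    by (intro packsI[of "y + z"])
      (simp_all add: sum.distrib matrix_vector_mult_def less_eq_vec_def algebra_simps add_mono)
qed

lemma packs_add_right: "packs A i a \<Longrightarrow> packs A i (a + b)"
  using packs_add[OF _ packs_zero] by force

lemma packs_mono: "packs A i a \<Longrightarrow> a \<le> b \<Longrightarrow> packs A i b"
  unfolding packs_def using order_trans by blast

lemma packs_column:
  fixes A :: "nat ^ 'q::finite ^ 'n::finite"
  shows "packs A 1 (column j A)"
proof (rule packsI)
  show "(\<Sum>k\<in>UNIV. (axis j 1 :: nat ^ 'q) $ k) = 1"
    by (simp add: axis_def)
  show "A *v axis j 1 \<le> column j A"
    by (simp add: matrix_vector_mult_def axis_def column_def less_eq_vec_def if_distrib cong: if_cong)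
qed

text \<open>A positive coordinate sum means that some column is used; giving back one copy of it
  frees exactly that column in \<open>a\<close>. On the monomial side this splits one generator off
  \<open>x^a\<close>, which drives the inductions on the power.\<close>

lemma packs_Suc_imp:
  fixes A :: "nat ^ 'q::finite ^ 'n::finite"
  assumes "packs A (Suc i) a"
  obtains j where "column j A \<le> a" "packs A i (a - column j A)"
proof -
  obtain y :: "nat ^ 'q" where y: "(\<Sum>k\<in>UNIV. y $ k) = Suc i" "A *v y \<le> a"
    using assms by (elim packsE)
  then obtain j where j: "y $ j > 0"
    by (metis gr0I sum.neutral nat.distinct(1))
  \<comment> \<open>Since \<open>y $ j\<close> is positive, the truncated subtraction on naturals is
    exact here, so adding \<open>axis j 1\<close> recovers \<open>y\<close>.\<close>
  define z where "z = y - axis j 1"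
  have y_eq: "y = z + axis j 1"
    using j by (auto simp: z_def vec_eq_iff axis_def)
  have Ay: "A *v y = A *v z + column j A"
    unfolding y_eq matrix_vector_right_distrib
    by (simp add: matrix_vector_mult_def axis_def column_def vec_eq_iff if_distrib cong: if_cong)
  have le: "(A *v z) $ k + column j A $ k \<le> a $ k" for k
    using y(2) by (simp add: Ay less_eq_vec_def)
  have "(\<Sum>k\<in>UNIV. z $ k) = i"
    using y(1) unfolding y_eq by (simp add: sum.distrib axis_def)
  moreover have "A *v z \<le> a - column j A"
    using le by (simp add: less_eq_vec_def add_le_imp_le_diff)
  ultimately have "packs A i (a - column j A)"
    by (rule packsI)
  moreover have "column j A \<le> a"
    using le by (auto simp: less_eq_vec_def intro: add_leD2)
  ultimately show thesis
    using that by blast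
qed

text \<open>Columns can be discarded one at a time, because what remains still fits under
  \<open>a\<close>. Prescribing the coordinate sum exactly is therefore no stronger than bounding it
  from below.\<close>

lemma packs_antimono:
  assumes "packs A i a" "j \<le> i"
  shows "packs A j a"
  using assms(2,1)
proof (induction rule: inc_induct)
  case (step k)
  then have "packs A (Suc k) a"
    by blast
  then obtain l where "packs A k (a - column l A)"
    by (rule packs_Suc_imp)
  then show ?case
    by (rule packs_mono) (simp add: less_eq_vec_def)
qed

section \<open>Ideals of the polynomial ring described by exponents\<close>

lemma ring_of_type_algebra_simps:
  "carrier ring_of_type_algebra = UNIV"
  "x \<otimes>\<^bsub>ring_of_type_algebra\<^esub> y = x * y"
  "x \<oplus>\<^bsub>ring_of_type_algebra\<^esub> y = x + y"
  "\<zero>\<^bsub>ring_of_type_algebra\<^esub> = 0"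
  "\<one>\<^bsub>ring_of_type_algebra\<^esub> = 1"
  by (simp_all add: ring_of_type_algebra_def)

lemma ideal_ring_of_type_algebraI:
  fixes J :: "'a::comm_ring_1 set"
  assumes zero: "0 \<in> J"
    and add: "\<And>x y. x \<in> J \<Longrightarrow> y \<in> J \<Longrightarrow> x + y \<in> J"
    and mult: "\<And>r x. x \<in> J \<Longrightarrow> r * x \<in> J"
  shows "ideal J ring_of_type_algebra"
proof -
  let ?R = "ring_of_type_algebra :: 'a ring"
  interpret R: cring ?R
    by (rule cring_from_type_algebra)
  show ?thesis
  proof (rule idealI)
    show "ring ?R"
      by (rule R.ring_axioms)
    show "subgroup J (add_monoid ?R)"
    proof (rule R.add.subgroupI)
      fix x assume x: "x \<in> J"
      have "\<ominus>\<^bsub>?R\<^esub> x = - x"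
        by (rule R.minus_equality) (simp_all add: ring_of_type_algebra_simps)
      with mult[OF x, of "- 1"] show "\<ominus>\<^bsub>?R\<^esub> x \<in> J"
        by simp
    qed (use zero add in \<open>auto simp: ring_of_type_algebra_simps\<close>)
  qed (use mult in \<open>auto simp: ring_of_type_algebra_simps mult.commute\<close>)
qed

lemma ideal_ring_of_type_algebraD:
  fixes J :: "'a::comm_ring_1 set"
  assumes "ideal J ring_of_type_algebra"
  shows "0 \<in> J"
    and "x \<in> J \<Longrightarrow> y \<in> J \<Longrightarrow> x + y \<in> J"
    and "x \<in> J \<Longrightarrow> r * x \<in> J"
proof -
  interpret J: ideal J "ring_of_type_algebra :: 'a ring"
    by (rule assms)
  show "0 \<in> J"
    using additive_subgroup.zero_closed[OF J.is_additive_subgroup] by (simp add: ring_of_type_algebra_simps)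
  show "x + y \<in> J" if "x \<in> J" "y \<in> J"
    using additive_subgroup.a_closed[OF J.is_additive_subgroup that] by (simp add: ring_of_type_algebra_simps)
  show "r * x \<in> J" if "x \<in> J"
    using J.I_l_closed[OF that, of r] by (simp add: ring_of_type_algebra_simps)
qed

lemma mono_pow_add: "mono_pow (a + b) = mono_pow a * mono_pow b"
  by (simp add: mono_pow_eq_single mult_single)

lemma mono_pow_power: "mono_pow a ^ p = mono_pow (p *s a)"
proof (induction p)
  case 0
  have "0 *s a = 0"
    by (simp add: vec_eq_iff)
  then show ?case
    by (simp add: mono_pow_eq_single)
next
  case (Suc p)
  have "Suc p *s a = a + p *s a"
    by (simp add: vec_eq_iff)
  with Suc show ?case
    by (simp add: mono_pow_add)
qed

lemma keys_mono_pow: "Poly_Mapping.keys (mono_pow a :: _ \<Rightarrow>\<^sub>0 'k::field) = {a}"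
  by (simp add: mono_pow_eq_single)

text \<open>A polynomial is the finite sum of its terms, and each term is a constant, placed at
  exponent 0, times a monomial of \<open>J\<close>.\<close>

lemma in_ideal_if_monomials_in_ideal:
  fixes f :: "(nat ^ 'n::finite) \<Rightarrow>\<^sub>0 'k::field"
  assumes J: "ideal J ring_of_type_algebra"
    and keys: "\<And>a. a \<in> Poly_Mapping.keys f \<Longrightarrow> mono_pow a \<in> J"
  shows "f \<in> J"
proof -
  let ?term = "\<lambda>a. Poly_Mapping.single a (Poly_Mapping.lookup f a)"
  have "(\<Sum>a\<in>S. ?term a) \<in> J" if "finite S" "S \<subseteq> Poly_Mapping.keys f" for S
    using that
  proof (induction S)
    case (insert a S)
    have "?term a = Poly_Mapping.single 0 (Poly_Mapping.lookup f a) * mono_pow a"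
      by (simp add: mono_pow_eq_single mult_single)
    then have "?term a \<in> J"
      using insert.prems keys by (simp add: ideal_ring_of_type_algebraD(3)[OF J])
    with insert show ?case
      by (simp add: ideal_ring_of_type_algebraD(2)[OF J])
  qed (simp add: ideal_ring_of_type_algebraD(1)[OF J])
  moreover have "(\<Sum>a\<in>Poly_Mapping.keys f. ?term a) = f"
    by (rule poly_mapping_eqI)
      (simp add: lookup_sum lookup_single when_def in_keys_iff)
  ultimately show ?thesis
    by (metis finite_keys order_refl)
qed

text \<open>Cancellation can only remove exponents from a sum, and every exponent of
  \<open>r * x\<close> is an exponent of \<open>x\<close> plus some vector. Closure of
  \<open>P\<close> under adding vectors is thus what multiplication needs.\<close>

lemma ideal_keys:
  fixes P :: "nat ^ 'n::finite \<Rightarrow> bool"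
  assumes "\<And>a b. P a \<Longrightarrow> P (a + b)"
  shows "ideal {f :: _ \<Rightarrow>\<^sub>0 'k::field. \<forall>a\<in>Poly_Mapping.keys f. P a} ring_of_type_algebra"
proof (rule ideal_ring_of_type_algebraI)
  fix x y :: "(nat ^ 'n) \<Rightarrow>\<^sub>0 'k"
  assume "x \<in> {f. \<forall>a\<in>Poly_Mapping.keys f. P a}" "y \<in> {f. \<forall>a\<in>Poly_Mapping.keys f. P a}"
  then show "x + y \<in> {f. \<forall>a\<in>Poly_Mapping.keys f. P a}"
    using Poly_Mapping.keys_add[of x y] by blast
next
  fix r x :: "(nat ^ 'n) \<Rightarrow>\<^sub>0 'k"
  assume "x \<in> {f. \<forall>a\<in>Poly_Mapping.keys f. P a}"
  then show "r * x \<in> {f. \<forall>a\<in>Poly_Mapping.keys f. P a}"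
    using keys_mult[of r x] assms by (fastforce simp: add.commute)
qed simp

text \<open>The right-hand side is an ideal containing the generators, so minimality gives one
  inclusion; assembling polynomials from their monomials gives the other.\<close>

lemma ideal_gen_mono_pow:
  fixes P :: "nat ^ 'n::finite \<Rightarrow> bool"
  assumes P: "\<And>a b. P a \<Longrightarrow> P (a + b)"
  shows "ideal_gen {mono_pow a | a. P a} =
    {f :: _ \<Rightarrow>\<^sub>0 'k::field. \<forall>a\<in>Poly_Mapping.keys f. P a}"
proof
  interpret R: cring "ring_of_type_algebra :: ((nat ^ 'n) \<Rightarrow>\<^sub>0 'k) ring"
    by (rule cring_from_type_algebra)
  let ?S = "{mono_pow a | a. P a} :: ((nat ^ 'n) \<Rightarrow>\<^sub>0 'k) set"
  have S: "?S \<subseteq> carrier ring_of_type_algebra"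
    by (simp add: ring_of_type_algebra_simps)
  show "ideal_gen ?S \<subseteq> {f. \<forall>a\<in>Poly_Mapping.keys f. P a}"
    by (rule R.genideal_minimal[OF ideal_keys]) (auto simp: P keys_mono_pow)
  show "{f. \<forall>a\<in>Poly_Mapping.keys f. P a} \<subseteq> ideal_gen ?S"
    using in_ideal_if_monomials_in_ideal[OF R.genideal_ideal[OF S]] R.genideal_self[OF S] by blast
qed

section \<open>Powers of a monomial ideal and normality\<close>

lemma ideal_pow_0: "ideal_pow J 0 = UNIV"
  by (simp add: nat_pow_def ideals_set_def ring_of_type_algebra_simps)

lemma ideal_pow_Suc: "ideal_pow J (Suc i) = ideal_prod ring_of_type_algebra (ideal_pow J i) J"
  by (simp add: nat_pow_def ideals_set_def)

lemma ideal_ideal_pow: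
  fixes J :: "'a::comm_ring_1 set"
  assumes "ideal J ring_of_type_algebra"
  shows "ideal (ideal_pow J i) ring_of_type_algebra"
proof -
  interpret R: cring "ring_of_type_algebra :: 'a ring"
    by (rule cring_from_type_algebra)
  show ?thesis
  proof (induction i)
    case 0
    show ?case
      using R.oneideal unfolding ideal_pow_0 ring_of_type_algebra_simps .
  next
    case (Suc i)
    then show ?case
      unfolding ideal_pow_Suc using assms by (rule R.ideal_prod_is_ideal)
  qed
qed

text \<open>Multiplying by a member of \<open>I\<close> adds exponents, and packings add
  accordingly; conversely, a packed monomial loses one generator per step of the induction.\<close>

lemma ideal_pow_monomial_ideal:
  fixes A :: "nat ^ 'q::finite ^ 'n::finite"
    and I :: "((nat ^ 'n) \<Rightarrow>\<^sub>0 'k::field) set"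
  assumes I: "I = ideal_gen (range (\<lambda>j. mono_pow (column j A)))"
  shows "ideal_pow I i = {f. \<forall>a\<in>Poly_Mapping.keys f. packs A i a}"
proof
  let ?R = "ring_of_type_algebra :: ((nat ^ 'n) \<Rightarrow>\<^sub>0 'k) ring"
  interpret R: cring ?R
    by (rule cring_from_type_algebra)
  have gens: "range (\<lambda>j. mono_pow (column j A)) \<subseteq> carrier ?R"
    by (simp add: ring_of_type_algebra_simps)
  have ideal_I: "ideal I ?R"
    unfolding I by (rule R.genideal_ideal[OF gens])
  have I_le: "I \<subseteq> {f. \<forall>a\<in>Poly_Mapping.keys f. packs A 1 a}"
    unfolding I
    by (rule R.genideal_minimal[OF ideal_keys])
      (use packs_column in \<open>auto simp: packs_add_right keys_mono_pow\<close>)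
  show "ideal_pow I i \<subseteq> {f. \<forall>a\<in>Poly_Mapping.keys f. packs A i a}"
  proof (induction i)
    case 0
    show ?case
      by (simp add: packs_zero)
  next
    case (Suc i)
    have "\<forall>a\<in>Poly_Mapping.keys f. packs A (Suc i) a"
      if "f \<in> ideal_prod ?R (ideal_pow I i) I" for f
      using that
    proof induction
      case (prod g h)
      then have g: "\<forall>a\<in>Poly_Mapping.keys g. packs A i a"
        and h: "\<forall>a\<in>Poly_Mapping.keys h. packs A 1 a"
        using Suc I_le by auto
      then show ?case
        using keys_mult[of g h] packs_add[of A i _ 1] by (fastforce simp: ring_of_type_algebra_simps)
    next
      case (sum g h)
      then show ?case
        using Poly_Mapping.keys_add[of g h] by (auto simp: ring_of_type_algebra_simps)
    qed
    then show ?case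
      unfolding ideal_pow_Suc by blast
  qed
  have mono_pow_in: "mono_pow a \<in> ideal_pow I i" if "packs A i a" for a
    using that
  proof (induction i arbitrary: a)
    case 0
    show ?case
      unfolding ideal_pow_0 by simp
  next
    case (Suc i)
    then obtain j where j: "column j A \<le> a" "packs A i (a - column j A)"
      by (elim packs_Suc_imp)
    \<comment> \<open>Truncated subtraction is undone because \<open>column j A\<close> lies below
      \<open>a\<close>.\<close>
    then have "a = (a - column j A) + column j A"
      by (simp add: vec_eq_iff less_eq_vec_def)
    then have a: "mono_pow a = mono_pow (a - column j A) * (mono_pow (column j A) :: _ \<Rightarrow>\<^sub>0 'k)"
      by (metis mono_pow_add)
    have "mono_pow (column j A) \<in> I"
      using R.genideal_self[OF gens] unfolding I by blast
    with Suc.IH[OF j(2)] show ?case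
      unfolding a ideal_pow_Suc ring_of_type_algebra_simps(2)[symmetric] by (rule ideal_prod.prod)
  qed
  show "{f. \<forall>a\<in>Poly_Mapping.keys f. packs A i a} \<subseteq> ideal_pow I i"
    using in_ideal_if_monomials_in_ideal[OF ideal_ideal_pow[OF ideal_I]] mono_pow_in by blast
qed

text \<open>The power and its integral closure both consist of all polynomials with exponents in a
  set closed under adding vectors, so comparing the ideals amounts to comparing the two sets. The
  resulting condition involves neither the field nor any ideal.\<close>

lemma normal_monomial_ideal_iff_packs:
  fixes A :: "nat ^ 'q::finite ^ 'n::finite"
    and I :: "((nat ^ 'n) \<Rightarrow>\<^sub>0 'k::field) set"
  assumes I: "I = ideal_gen (range (\<lambda>j. mono_pow (column j A)))"
  shows "normal_monomial_ideal I \<longleftrightarrow>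
    (\<forall>i\<ge>1. \<forall>a. (\<exists>p\<ge>1. packs A (p * i) (p *s a)) \<longrightarrow> packs A i a)"
proof -
  let ?Q = "\<lambda>i a. \<exists>p\<ge>1. packs A (p * i) (p *s a)"
  \<comment> \<open>The same \<open>p\<close> serves for \<open>a + b\<close>, since scaling
    distributes over the sum; this closure makes \<open>ideal_gen_mono_pow\<close> applicable to the
    integral closure.\<close>
  have Q_add: "?Q i (a + b)" if "?Q i a" for i a b
    using that packs_add_right[of A _ _ "_ *s b"] by (metis vector_add_ldistrib)
  have pow_iff: "mono_pow a \<in> ideal_pow I i \<longleftrightarrow> packs A i a" for i a
    by (simp add: ideal_pow_monomial_ideal[OF I] keys_mono_pow)
  have closure: "integral_closure_pow I i = {f. \<forall>a\<in>Poly_Mapping.keys f. ?Q i a}" for i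
    unfolding integral_closure_pow_def mono_pow_power pow_iff
    using Q_add by (intro ideal_gen_mono_pow)
  have packs_imp: "?Q i a" if "packs A i a" for i a
    using that by (intro exI[of _ 1]) (simp del: One_nat_def)
  have "ideal_pow I i = integral_closure_pow I i \<longleftrightarrow> (\<forall>a. ?Q i a \<longrightarrow> packs A i a)" for i
  proof
    assume "ideal_pow I i = integral_closure_pow I i"
    then show "\<forall>a. ?Q i a \<longrightarrow> packs A i a"
      unfolding closure using pow_iff[of _ i] by (auto simp: keys_mono_pow)
  next
    assume "\<forall>a. ?Q i a \<longrightarrow> packs A i a"
    with packs_imp show "ideal_pow I i = integral_closure_pow I i"
      unfolding closure ideal_pow_monomial_ideal[OF I] by blast
  qed
  then show ?thesis
    unfolding normal_monomial_ideal_def by simp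
qed

section \<open>Real solutions, rational solutions and packings\<close>

lemma Dirichlet_approx_simult_finite:
  fixes \<theta> :: "'q::finite \<Rightarrow> real"
  assumes "N > 0"
  obtains q :: nat and p where "q > 0" "\<And>j. \<bar>real q * \<theta> j - of_int (p j)\<bar> < 1 / real N"
proof -
  \<comment> \<open>An enumeration of the index type carries over Dirichlet's theorem, which is
    stated for an initial segment of the naturals.\<close>
  obtain h where h: "bij_betw h {0..<CARD('q)} (UNIV :: 'q set)"
    using ex_bij_betw_nat_finite[of "UNIV :: 'q set"] by auto
  obtain q p where q: "0 < q"
    and p: "\<And>i. i < CARD('q) \<Longrightarrow> \<bar>of_int q * \<theta> (h i) - of_int (p i)\<bar> < 1 / real N"
    by (rule Dirichlet_approx_simult[OF assms, of "CARD('q)" "\<lambda>i. \<theta> (h i)"]) blast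
  have "\<bar>real (nat q) * \<theta> j - of_int (p (inv_into {0..<CARD('q)} h j))\<bar> < 1 / real N" for j
    using p[of "inv_into {0..<CARD('q)} h j"] h q
      bij_betw_inv_into_right[OF h, of j] bij_betwE[OF bij_betw_inv_into[OF h]] by auto
  with q show thesis
    by (intro that[of "nat q"]) auto
qed

lemma map_matrix_real_mult_nth: "(map_matrix real A *v y) $ i = (\<Sum>j\<in>UNIV. real (A $ i $ j) * y $ j)"
  by (simp add: matrix_vector_mult_def map_matrix_def)

lemma inner_one_eq_sum: "y \<bullet> 1 = (\<Sum>j\<in>UNIV. y $ j)" for y :: "real ^ 'q::finite"
  by (simp add: inner_vec_def)

lemma lp_feasible_iff:
  "y \<in> lp_feasible A w \<longleftrightarrow>
    (\<forall>j. 0 \<le> y $ j) \<and> (\<forall>i. (\<Sum>j\<in>UNIV. real (A $ i $ j) * y $ j) \<le> w $ i)"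
  by (simp add: lp_feasible_def less_eq_vec_def map_matrix_real_mult_nth)

lemma ip_feasible_subset_lp_feasible: "ip_feasible A w \<subseteq> lp_feasible A w"
  by (auto simp: ip_feasible_def lp_feasible_def less_eq_vec_def Nats_altdef2)

text \<open>Dividing a packing of \<open>p *s a\<close> by \<open>p\<close> yields a rational point
  of the real problem. The converse passage, from real points, is
  \<open>multiple_packs_if_lp_feasible\<close>.\<close>

lemma lp_feasible_if_multiple_packs:
  fixes A :: "nat ^ 'q::finite ^ 'n::finite"
  assumes "p \<ge> 1" "packs A (p * i) (p *s a)"
  obtains y where "y \<in> lp_feasible A (\<chi> k. real (a $ k))" "y \<bullet> 1 = real i"
proof -
  obtain y :: "nat ^ 'q" where y: "(\<Sum>j\<in>UNIV. y $ j) = p * i" "A *v y \<le> p *s a"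
    using assms(2) by (elim packsE)
  have "real (\<Sum>j\<in>UNIV. A $ k $ j * y $ j) \<le> real (p * a $ k)" for k
    using y(2) by (simp only: of_nat_le_iff) (simp add: less_eq_vec_def matrix_vector_mult_def)
  then have "(\<chi> j. real (y $ j) / real p) \<in> lp_feasible A (\<chi> k. real (a $ k))"
    using assms(1)
    by (simp add: lp_feasible_iff sum_divide_distrib[symmetric] divide_le_eq mult.commute)
  moreover have "(\<chi> j. real (y $ j) / real p) \<bullet> 1 = real i"
    using assms(1) y(1)
    by (simp add: inner_one_eq_sum sum_divide_distrib[symmetric] flip: of_nat_sum)
  ultimately show thesis
    by (rule that)
qed

text \<open>
  An optimal real solution need not be rational. Simultaneous approximation moves a multiple of it
  to an integer point at a cost smaller than 1 in each constraint, and integrality absorbs this cost.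
\<close>

lemma multiple_packs_if_lp_feasible:
  fixes A :: "nat ^ 'q::finite ^ 'n::finite"
  assumes y: "y \<in> lp_feasible A (\<chi> k. real (a $ k))" and i: "real i \<le> y \<bullet> 1"
  shows "\<exists>p\<ge>1. packs A (p * i) (p *s a)"
proof -
  \<comment> \<open>\<open>N\<close> exceeds both the number of columns and every row sum of
    \<open>A\<close>. Coordinate errors below \<open>1 / N\<close> then add up to less than 1 in the
    objective and in each constraint.\<close>
  define N where "N = Suc (CARD('q) + (\<Sum>k\<in>UNIV. \<Sum>j\<in>UNIV. A $ k $ j))"
  have N: "N > 0"
    by (simp add: N_def)
  obtain p :: nat and z where p: "p > 0"
    and z: "\<And>j. \<bar>real p * y $ j - of_int (z j)\<bar> < 1 / real N"
    using Dirichlet_approx_simult_finite[OF N] by metis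
  define x :: "nat ^ 'q" where "x = (\<chi> j. nat (z j))"
  \<comment> \<open>An integer at distance less than 1 from a nonnegative real is greater than -1,
    so \<open>nat\<close> in the definition of \<open>x\<close> does not truncate.\<close>
  have "z j \<ge> 0" for j
  proof -
    have "0 \<le> real p * y $ j" "1 / real N \<le> 1"
      using y N by (auto simp: lp_feasible_iff)
    with z[of j] show ?thesis
      by linarith
  qed
  then have x: "\<bar>real p * y $ j - real (x $ j)\<bar> < 1 / real N" for j
    using z[of j] by (simp add: x_def)
  \<comment> \<open>Rounding lowers the objective by less than 1. Since \<open>p * i\<close> and the
    coordinate sum of \<open>x\<close> are integers, the sum cannot fall below
    \<open>p * i\<close>.\<close>
  have "(\<Sum>j\<in>UNIV. real p * y $ j - real (x $ j)) \<le> (\<Sum>j\<in>(UNIV :: 'q set). 1 / real N)"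
    using x by (intro sum_mono) (meson abs_le_D1 less_imp_le)
  also have "\<dots> < 1"
  proof -
    have "CARD('q) < N"
      by (simp add: N_def)
    then show ?thesis
      by simp
  qed
  finally have "real p * (y \<bullet> 1) < real (\<Sum>j\<in>UNIV. x $ j) + 1"
    by (simp add: inner_one_eq_sum sum_subtractf sum_distrib_left)
  moreover have "real (p * i) \<le> real p * (y \<bullet> 1)"
    using i by (simp add: mult_left_mono)
  ultimately have le_sum: "p * i \<le> (\<Sum>j\<in>UNIV. x $ j)"
    by linarith
  have "(A *v x) $ k \<le> (p *s a) $ k" for k
  proof -
    \<comment> \<open>The error bound is now used in the other direction: row \<open>k\<close> rises
      by less than 1 above a real value of at most \<open>p * a $ k\<close>, and integrality
      restores the constraint.\<close>
    have "(\<Sum>j\<in>UNIV. real (A $ k $ j) * (real (x $ j) - real p * y $ j))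
        \<le> (\<Sum>j\<in>UNIV. real (A $ k $ j) * (1 / real N))"
      using x by (intro sum_mono mult_left_mono) (auto simp: abs_less_iff less_imp_le)
    also have "\<dots> = real (\<Sum>j\<in>UNIV. A $ k $ j) / real N"
      by (simp add: sum_divide_distrib)
    also have "\<dots> < 1"
    proof -
      have "(\<Sum>j\<in>UNIV. A $ k $ j) \<le> (\<Sum>k\<in>UNIV. \<Sum>j\<in>UNIV. A $ k $ j)"
        by (rule member_le_sum) auto
      then have "(\<Sum>j\<in>UNIV. A $ k $ j) < N"
        by (simp add: N_def)
      then show ?thesis
        using N by (simp del: of_nat_sum)
    qed
    finally have "real ((A *v x) $ k) < real p * (\<Sum>j\<in>UNIV. real (A $ k $ j) * y $ j) + 1"
      by (simp add: matrix_vector_mult_def right_diff_distrib sum_subtractf sum_distrib_left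
          mult.left_commute)
    also have "\<dots> \<le> real ((p *s a) $ k) + 1"
      using y by (simp add: lp_feasible_iff mult_left_mono)
    finally show ?thesis
      by linarith
  qed
  then have "packs A (\<Sum>j\<in>UNIV. x $ j) (p *s a)"
    by (intro packsI[OF refl]) (simp add: less_eq_vec_def)
  \<comment> \<open>The coordinate sum of \<open>x\<close> may exceed \<open>p * i\<close>; the
    surplus is discarded.\<close>
  with p le_sum show ?thesis
    by (intro exI[of _ p]) (auto intro: packs_antimono)
qed

lemma packs_iff_ip_feasible:
  fixes A :: "nat ^ 'q::finite ^ 'n::finite"
  shows "packs A i a \<longleftrightarrow> (\<exists>y\<in>ip_feasible A (\<chi> k. real (a $ k)). y \<bullet> 1 = real i)"
proof
  assume "packs A i a"
  then obtain x :: "nat ^ 'q" where x: "(\<Sum>j\<in>UNIV. x $ j) = i" "A *v x \<le> a"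
    by (elim packsE)
  have "real (\<Sum>j\<in>UNIV. A $ k $ j * x $ j) \<le> real (a $ k)" for k
    using x(2) by (simp only: of_nat_le_iff) (simp add: less_eq_vec_def matrix_vector_mult_def)
  then have "(\<chi> j. real (x $ j)) \<in> ip_feasible A (\<chi> k. real (a $ k))"
    by (simp add: ip_feasible_def less_eq_vec_def map_matrix_real_mult_nth)
  moreover have "(\<chi> j. real (x $ j)) \<bullet> 1 = real i"
    using x(1) by (simp add: inner_one_eq_sum flip: of_nat_sum)
  ultimately show "\<exists>y\<in>ip_feasible A (\<chi> k. real (a $ k)). y \<bullet> 1 = real i"
    by blast
next
  assume "\<exists>y\<in>ip_feasible A (\<chi> k. real (a $ k)). y \<bullet> 1 = real i"
  then obtain y where y: "y \<in> ip_feasible A (\<chi> k. real (a $ k))" "y \<bullet> 1 = real i"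
    by blast
  from y(1) obtain x where x: "\<And>j. y $ j = real (x j)"
    unfolding ip_feasible_def Nats_def by (simp add: image_iff) metis
  show "packs A i a"
  proof (rule packsI)
    show "(\<Sum>j\<in>UNIV. (\<chi> j. x j) $ j) = i"
      using y(2) by (simp add: inner_one_eq_sum x flip: of_nat_sum)
    have "real (\<Sum>j\<in>UNIV. A $ k $ j * x j) \<le> real (a $ k)" for k
      using y(1) by (simp add: ip_feasible_def less_eq_vec_def map_matrix_real_mult_nth x)
    then show "A *v (\<chi> j. x j) \<le> a"
      by (simp only: of_nat_le_iff) (simp add: less_eq_vec_def matrix_vector_mult_def)
  qed
qed

section \<open>Compactness and the integer rounding property\<close>

lemma compact_lp_feasible:
  fixes A :: "nat ^ 'q::finite ^ 'n::finite"
  assumes "\<forall>j. column j A \<noteq> 0"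
  shows "compact (lp_feasible A w)"
proof -
  have "lp_feasible A w \<subseteq> {0..(\<chi> j. \<Sum>i\<in>UNIV. \<bar>w $ i\<bar>)}"
  proof
    fix y assume "y \<in> lp_feasible A w"
    then have y: "0 \<le> y $ j" "(\<Sum>j\<in>UNIV. real (A $ i $ j) * y $ j) \<le> w $ i" for i j
      by (auto simp: lp_feasible_iff)
    \<comment> \<open>A nonzero entry of column \<open>j\<close> is at least 1 and all terms of its
      row are nonnegative, so that row's constraint bounds \<open>y $ j\<close>. Summing over all
      rows makes the bound independent of the row chosen.\<close>
    have "y $ j \<le> (\<Sum>i\<in>UNIV. \<bar>w $ i\<bar>)" for j
    proof -
      from assms obtain i where "A $ i $ j \<noteq> 0"
        by (auto simp: column_def vec_eq_iff)
      then have "y $ j \<le> real (A $ i $ j) * y $ j"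
        using y(1)[of j] by (intro mult_le_cancel_right1[THEN iffD2]) auto
      also have "\<dots> \<le> (\<Sum>j\<in>UNIV. real (A $ i $ j) * y $ j)"
        using y(1) by (intro member_le_sum) auto
      also have "\<dots> \<le> \<bar>w $ i\<bar>"
        using y(2)[of i] by linarith
      also have "\<dots> \<le> (\<Sum>i\<in>UNIV. \<bar>w $ i\<bar>)"
        by (intro member_le_sum) auto
      finally show ?thesis .
    qed
    with y(1) show "y \<in> {0..(\<chi> j. \<Sum>i\<in>UNIV. \<bar>w $ i\<bar>)}"
      by (simp add: less_eq_vec_def)
  qed
  then have "bounded (lp_feasible A w)"
    by (metis bounded_cbox bounded_subset interval_cbox_cart)
  \<comment> \<open>The feasible set is a finite intersection of closed half-spaces.\<close>
  moreover have "closed (lp_feasible A w)"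
    unfolding lp_feasible_iff[abs_def] set_eq_iff
    by (subst Collect_mem_eq[symmetric], unfold lp_feasible_iff)
      (intro closed_Collect_conj closed_Collect_all closed_Collect_le continuous_intros)
  ultimately show ?thesis
    by (simp add: compact_eq_bounded_closed)
qed

text \<open>By \<open>packs_antimono\<close>, the integer values attained by packings form an
  initial segment. Reaching the floor of the real maximum is thus the same as attaining every
  positive integer value of the relaxation, which is the condition found for normality.\<close>

lemma integer_rounding_property_iff_packs:
  fixes A :: "nat ^ 'q::finite ^ 'n::finite"
  assumes A: "\<forall>j. column j A \<noteq> 0"
  shows "integer_rounding_property A \<longleftrightarrow>
    (\<forall>i\<ge>1. \<forall>a. (\<exists>p\<ge>1. packs A (p * i) (p *s a)) \<longrightarrow> packs A i a)"
proof (intro iffI allI impI)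
  fix i a
  assume irp: "integer_rounding_property A" and "\<exists>p\<ge>1. packs A (p * i) (p *s a)"
  let ?w = "\<chi> k. real (a $ k)"
  from \<open>\<exists>p\<ge>1. packs A (p * i) (p *s a)\<close> obtain x where x: "x \<in> lp_feasible A ?w" "x \<bullet> 1 = real i"
    using lp_feasible_if_multiple_packs by metis
  \<comment> \<open>Compactness supplies the finiteness of the real maximum that the integer
    rounding property presupposes.\<close>
  have "compact ((\<lambda>y. y \<bullet> 1) ` lp_feasible A ?w)"
    by (intro compact_continuous_image continuous_intros compact_lp_feasible[OF A])
  then have "bdd_above ((\<lambda>y. y \<bullet> 1) ` lp_feasible A ?w)"
    by (intro bounded_imp_bdd_above compact_imp_bounded)
  with irp x(1) obtain y z where y: "is_arg_max (\<lambda>y. y \<bullet> 1) (\<lambda>y. y \<in> ip_feasible A ?w) y"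
    and z: "is_arg_max (\<lambda>z. z \<bullet> 1) (\<lambda>z. z \<in> lp_feasible A ?w) z"
    and yz: "y \<bullet> 1 = of_int \<lfloor>z \<bullet> 1\<rfloor>"
    unfolding integer_rounding_property_def by (force simp: Ints_of_nat)
  have "real i \<le> z \<bullet> 1"
    using z x by (auto simp: is_arg_max_linorder)
  then have le: "int i \<le> \<lfloor>z \<bullet> 1\<rfloor>"
    by (simp add: le_floor_iff)
  \<comment> \<open>The floor is at least \<open>int i\<close>, hence nonnegative, and passing to
    \<open>nat\<close> loses nothing. The integer optimum may lie above \<open>i\<close>, so one
    descends from it.\<close>
  then have "y \<bullet> 1 = real (nat \<lfloor>z \<bullet> 1\<rfloor>)"
    using yz by simp
  then have "packs A (nat \<lfloor>z \<bullet> 1\<rfloor>) a"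
    using y unfolding packs_iff_ip_feasible is_arg_max_linorder by blast
  then show "packs A i a"
    by (rule packs_antimono) (use le in linarith)
next
  assume packs: "\<forall>i\<ge>1. \<forall>a. (\<exists>p\<ge>1. packs A (p * i) (p *s a)) \<longrightarrow> packs A i a"
  show "integer_rounding_property A"
    unfolding integer_rounding_property_def
  proof (intro allI impI)
    fix w :: "real ^ 'n"
    assume int: "\<forall>i. w $ i \<in> \<int>" and ne: "lp_feasible A w \<noteq> {}"
    then obtain x where x: "x \<in> lp_feasible A w"
      by blast
    \<comment> \<open>\<open>A\<close> and the feasible point are nonnegative, so feasibility forces
      \<open>w\<close> to be nonnegative; being integral, it is then an exponent vector.\<close>
    have w_nonneg: "0 \<le> w $ i" for i
    proof -
      have "0 \<le> (\<Sum>j\<in>UNIV. real (A $ i $ j) * x $ j)"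
        using x by (intro sum_nonneg) (simp add: lp_feasible_iff)
      also have "\<dots> \<le> w $ i"
        using x by (simp add: lp_feasible_iff)
      finally show ?thesis .
    qed
    define a where "a = (\<chi> i. nat \<lfloor>w $ i\<rfloor>)"
    have w: "w = (\<chi> k. real (a $ k))"
      using int w_nonneg by (auto simp: a_def vec_eq_iff elim!: Ints_cases)
    obtain z where z: "z \<in> lp_feasible A w" "\<And>y. y \<in> lp_feasible A w \<Longrightarrow> y \<bullet> 1 \<le> z \<bullet> 1"
    proof -
      have "\<exists>z\<in>lp_feasible A w. \<forall>y\<in>lp_feasible A w. y \<bullet> 1 \<le> z \<bullet> 1"
        by (intro continuous_attains_sup compact_lp_feasible[OF A] ne continuous_intros)
      with that show thesis
        by blast
    qed
    define i where "i = nat \<lfloor>z \<bullet> 1\<rfloor>"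
    have "0 \<le> z \<bullet> 1"
      using z(1) by (auto simp: inner_one_eq_sum lp_feasible_iff intro: sum_nonneg)
    then have i: "real i = of_int \<lfloor>z \<bullet> 1\<rfloor>"
      by (simp add: i_def)
    have "packs A i a"
    \<comment> \<open>The condition speaks only of positive \<open>i\<close>; for the value 0 the
      empty packing serves.\<close>
    proof (cases "i = 0")
      case False
      then have "i \<ge> 1"
        by simp
      moreover have "real i \<le> z \<bullet> 1"
        unfolding i by simp
      ultimately show ?thesis
        using packs multiple_packs_if_lp_feasible[OF z(1)[unfolded w]] by blast
    qed (simp add: packs_zero)
    then obtain y where y: "y \<in> ip_feasible A w" "y \<bullet> 1 = real i"
      unfolding packs_iff_ip_feasible w by blast
    \<comment> \<open>An integer point has an integer objective value, bounded by the real maximum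
      and hence by its floor, which \<open>y\<close> attains.\<close>
    have "u \<bullet> 1 \<le> y \<bullet> 1" if "u \<in> ip_feasible A w" for u
    proof -
      have "u \<bullet> 1 \<in> \<int>"
        using that Nats_subset_Ints
        by (auto simp: ip_feasible_def inner_one_eq_sum intro!: Ints_sum)
      moreover have "u \<bullet> 1 \<le> z \<bullet> 1"
        using z(2) that ip_feasible_subset_lp_feasible by blast
      ultimately show ?thesis
        unfolding y(2) i by (auto elim!: Ints_cases simp: le_floor_iff)
    qed
    with y z i show "\<exists>y z. is_arg_max (\<lambda>y. y \<bullet> 1) (\<lambda>y. y \<in> ip_feasible A w) y \<and>
        is_arg_max (\<lambda>z. z \<bullet> 1) (\<lambda>z. z \<in> lp_feasible A w) z \<and> y \<bullet> 1 = of_int \<lfloor>z \<bullet> 1\<rfloor>"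
      by (intro exI[of _ y] exI[of _ z]) (auto simp: is_arg_max_linorder)
  qed
qed

theorem corollary1p1p8:
  fixes v :: "'q::finite \<Rightarrow> nat ^ 'n::finite"
    and A :: "nat ^ 'q ^ 'n"
    and I :: "((nat ^ 'n) \<Rightarrow>\<^sub>0 'k::field) set"
  assumes "A = (\<chi> i j. v j $ i)"
    and "\<forall>i. row i A \<noteq> 0"
    and "\<forall>j. column j A \<noteq> 0"
    and "I = ideal_gen (range (\<lambda>j. mono_pow (v j)))"
  shows "normal_monomial_ideal I \<longleftrightarrow> integer_rounding_property A"
proof -
  have "v j = column j A" for j
    by (simp add: assms(1) column_def vec_eq_iff)
  with assms(4) have "I = ideal_gen (range (\<lambda>j. mono_pow (column j A)))"
    by simp
  then show ?thesis
    using normal_monomial_ideal_iff_packs integer_rounding_property_iff_packs[OF assms(3)] by blast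
qed

end
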